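(* Let $(\mathcal L,\mathcal P)$ be an extremal configuration and let $C_1,\dots,C_{r^2}$ be a point weighted cell decomposition with $r\sim N^{1/3\pm}$. Then there is a subset $\mathcal L'\subset\mathcal L$ such that $|I(\mathcal L',\mathcal P)|\gtrsim N^{4/3-}$ and every $L\in\mathcal L'$ is incident to points in $\gtrsim N^{1/3-}$ cells.
   Context: Conventions: $N$ is a large parameter and $\epsilon_0>0$ a fixed small exponent. $A\lesssim B$ means $A\le CB$ with $C$ independent of $N$. $N^{a+}$ (resp. $N^{a-}$) denotes $N^{a+\epsilon}$ (resp. $N^{a-\epsilon}$) for some $0\le\epsilon\lesssim\epsilon_0$, possibly different at each occurrence; $r\sim N^{a\pm}$ means $N^{a-}\lesssim r\lesssim N^{a+}$. A configuration $(\mathcal L,\mathcal P)$ is a set $\mathcal L$ of lines and a set $\mathcal P$ of points in $\mathbb R^2$ with $N^{1-}\lesssim|\mathcal L|,|\mathcal P|\le N$; $I(\mathcal L,\mathcal P)$ is the set of incident pairs; it is extremal if $|I(\mathcal L,\mathcal P)|\gtrsim N^{4/3-}$. A partition of $\mathcal P$ into $r^2$ disjoint subsets (cells) is a point weighted cell decomposition if no line of $\mathcal L$ is incident to points in $\gtrsim r$ cells and no cell contains $\gtrsim N^{1+}/r^2$ points of $\mathcal P$. *)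

theory Defs
  imports "HOL-Analysis.Analysis"
begin

text \<open>
  Asymptotic notation. Implied constants are made explicit: \<open>C\<close> is the implied constant of
  \<open>\<lesssim>\<close> between quantities, and \<open>K\<close> the one in the admissible exponent losses
  \<open>0 \<le> \<epsilon> \<lesssim> \<epsilon>\<^sub>0\<close>, that is \<open>0 \<le> \<epsilon> \<le> K * \<epsilon>\<^sub>0\<close>. For \<open>N \<ge> 1\<close> every predicate below
  becomes weaker as \<open>K\<close> and \<open>C\<close> grow, so one pair \<open>(K, C)\<close> can serve for
  finitely many occurrences of the notation.
\<close>

text \<open>\<open>A \<gtrsim> N\<^sup>a\<^sup>-\<close>:\<close>

definition gtrsim_minus :: "real \<Rightarrow> real \<Rightarrow> real \<Rightarrow> real \<Rightarrow> real \<Rightarrow> real \<Rightarrow> bool" where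
  "gtrsim_minus K C \<epsilon>0 N a A \<longleftrightarrow>
     (\<exists>\<epsilon>. 0 \<le> \<epsilon> \<and> \<epsilon> \<le> K * \<epsilon>0 \<and> N powr (a - \<epsilon>) \<le> C * A)"

text \<open>\<open>A \<lesssim> N\<^sup>a\<^sup>+\<close>:\<close>

definition lesssim_plus :: "real \<Rightarrow> real \<Rightarrow> real \<Rightarrow> real \<Rightarrow> real \<Rightarrow> real \<Rightarrow> bool" where
  "lesssim_plus K C \<epsilon>0 N a A \<longleftrightarrow>
     (\<exists>\<epsilon>. 0 \<le> \<epsilon> \<and> \<epsilon> \<le> K * \<epsilon>0 \<and> A \<le> C * N powr (a + \<epsilon>))"

text \<open>\<open>A \<sim> N\<^sup>a\<^sup>\<plusminus>\<close>:\<close>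

definition sim_plusminus :: "real \<Rightarrow> real \<Rightarrow> real \<Rightarrow> real \<Rightarrow> real \<Rightarrow> real \<Rightarrow> bool" where
  "sim_plusminus K C \<epsilon>0 N a A \<longleftrightarrow>
     gtrsim_minus K C \<epsilon>0 N a A \<and> lesssim_plus K C \<epsilon>0 N a A"

definition is_line :: "(real ^ 2) set \<Rightarrow> bool" where
  "is_line l \<longleftrightarrow> affine l \<and> aff_dim l = 1"

definition incidences :: "(real ^ 2) set set \<Rightarrow> (real ^ 2) set \<Rightarrow> ((real ^ 2) set \<times> (real ^ 2)) set" where
  "incidences L P = {(l, p). l \<in> L \<and> p \<in> P \<and> p \<in> l}"

definition configuration ::
  "real \<Rightarrow> real \<Rightarrow> real \<Rightarrow> real \<Rightarrow> (real ^ 2) set set \<Rightarrow> (real ^ 2) set \<Rightarrow> bool" where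
  "configuration K C \<epsilon>0 N L P \<longleftrightarrow>
     finite L \<and> finite P \<and> (\<forall>l\<in>L. is_line l) \<and>
     gtrsim_minus K C \<epsilon>0 N 1 (real (card L)) \<and> real (card L) \<le> N \<and>
     gtrsim_minus K C \<epsilon>0 N 1 (real (card P)) \<and> real (card P) \<le> N"

definition extremal_configuration ::
  "real \<Rightarrow> real \<Rightarrow> real \<Rightarrow> real \<Rightarrow> (real ^ 2) set set \<Rightarrow> (real ^ 2) set \<Rightarrow> bool" where
  "extremal_configuration K C \<epsilon>0 N L P \<longleftrightarrow>
     configuration K C \<epsilon>0 N L P \<and>
     gtrsim_minus K C \<epsilon>0 N (4/3) (real (card (incidences L P)))"

text \<open>The number of cells among \<open>X 1, \<dots>, X m\<close> containing a point incident to \<open>l\<close>.\<close>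

definition num_cells :: "nat \<Rightarrow> (nat \<Rightarrow> (real ^ 2) set) \<Rightarrow> (real ^ 2) set \<Rightarrow> nat" where
  "num_cells m X l = card {i \<in> {1..m}. \<exists>p \<in> X i. p \<in> l}"

text \<open>
  The cells are \<open>X 1, \<dots>, X m\<close> with \<open>m = r\<^sup>2\<close>; \<open>r\<close> itself need not be an integer, and cells may
  be empty. ``No line is incident to points in \<open>\<gtrsim> r\<close> cells'' says that every line is
  incident to points in \<open>\<lesssim> r\<close> cells, and similarly for the points in a cell.
\<close>

definition point_weighted_cell_decomposition ::
  "real \<Rightarrow> real \<Rightarrow> real \<Rightarrow> real \<Rightarrow> (real ^ 2) set set \<Rightarrow> (real ^ 2) set \<Rightarrow>
   real \<Rightarrow> nat \<Rightarrow> (nat \<Rightarrow> (real ^ 2) set) \<Rightarrow> bool" where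
  "point_weighted_cell_decomposition K C \<epsilon>0 N L P r m X \<longleftrightarrow>
     0 < r \<and> real m = r\<^sup>2 \<and>
     disjoint_family_on X {1..m} \<and> (\<Union>i\<in>{1..m}. X i) = P \<and>
     (\<forall>l\<in>L. real (num_cells m X l) \<le> C * r) \<and>
     (\<exists>\<epsilon>. 0 \<le> \<epsilon> \<and> \<epsilon> \<le> K * \<epsilon>0 \<and>
        (\<forall>i\<in>{1..m}. real (card (X i)) \<le> C * (N powr (1 + \<epsilon>) / r\<^sup>2)))"

end

theory Submission
  imports Defs
begin

text \<open>
  If a line meets a cell in \<open>n > 0\<close> points, then \<open>n \<le> 1 + t + n * (n - 1) / t\<close> for every \<open>t > 0\<close>.
  Summed over all cells and all lines meeting at most \<open>s\<close> cells, the first part contributes at most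
  \<open>(1 + t) * s * N\<close>, and since two points lie on at most one common line, the second part contributes at
  most \<open>(\<Sum>\<^sub>i \<bar>C\<^sub>i\<bar>\<^sup>2) / t\<close>, which is at most about \<open>N\<^sup>4\<^sup>/\<^sup>3\<^sup>+ / t\<close>. Taking \<open>t\<close> to be a large enough
  power \<open>N\<^sup>0\<^sup>+\<close>, and then \<open>s\<close> to be a small enough \<open>N\<^sup>1\<^sup>/\<^sup>3\<^sup>-\<close>, the lines meeting at most \<open>s\<close> cells
  account for at most half of the incidences.
\<close>

lemma card_incidences:
  assumes "finite L" "finite P"
  shows "card (incidences L P) = (\<Sum>l\<in>L. card (l \<inter> P))"
proof -
  have "incidences L P = (SIGMA l:L. l \<inter> P)"
    by (auto simp: incidences_def)
  then show ?thesis
    using assms by simp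
qed

text \<open>Each of the two lines equals the affine hull of \<open>{p, q}\<close>. The hull lies in
  the line, and a proper inclusion of affine hulls would raise the dimension, but both have
  dimension 1 because \<open>p\<close> and \<open>q\<close> are distinct.\<close>

lemma is_line_eq:
  assumes "is_line l" "is_line l'" "p \<noteq> q" "{p, q} \<subseteq> l" "{p, q} \<subseteq> l'"
  shows "l = l'"
proof -
  have "affine hull {p, q} = k" if k: "is_line k" "{p, q} \<subseteq> k" for k
  proof (rule ccontr)
    assume "affine hull {p, q} \<noteq> k"
    moreover have "affine hull k = k"
      using k by (simp add: is_line_def affine_hull_eq)
    ultimately have "affine hull {p, q} \<subset> affine hull k"
      using hull_mono[OF k(2), of affine] by (simp only: psubset_eq) simp
    then have "aff_dim {p, q} < aff_dim k"
      by (rule aff_dim_psubset)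
    then show False
      using k \<open>p \<noteq> q\<close> by (simp add: is_line_def)
  qed
  then show ?thesis
    using assms by metis
qed

text \<open>The summand counts ordered pairs of distinct points of \<open>S\<close> on
  \<open>l\<close>. Such a pair determines its line, so the sets of pairs for different lines are
  disjoint subsets of \<open>S \<times> S\<close>.\<close>

lemma sum_collinear_pairs_le:
  assumes "finite B" "finite S" "\<forall>l\<in>B. is_line l"
  shows "(\<Sum>l\<in>B. card (l \<inter> S) * (card (l \<inter> S) - 1)) \<le> (card S)\<^sup>2"
proof -
  define D where "D l = (SIGMA p:l \<inter> S. (l \<inter> S) - {p})" for l :: "(real ^ 2) set"
  have fin: "finite (D l)" for l
    using assms unfolding D_def by auto
  have "card (D l) = card (l \<inter> S) * (card (l \<inter> S) - 1)" for l
    using assms unfolding D_def by simp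
  then have "(\<Sum>l\<in>B. card (l \<inter> S) * (card (l \<inter> S) - 1)) = (\<Sum>l\<in>B. card (D l))"
    by simp
  also have "\<dots> = card (\<Union>l\<in>B. D l)"
  proof (rule card_UN_disjoint[symmetric])
    show "\<forall>l\<in>B. \<forall>l'\<in>B. l \<noteq> l' \<longrightarrow> D l \<inter> D l' = {}"
    proof (intro ballI impI)
      fix l l' assume l: "l \<in> B" "l' \<in> B" "l \<noteq> l'"
      show "D l \<inter> D l' = {}"
        using is_line_eq[of l l'] l assms(3) unfolding D_def by auto
    qed
  qed (use assms fin in auto)
  also have "\<dots> \<le> card (S \<times> S)"
    by (rule card_mono) (use assms in \<open>auto simp: D_def\<close>)
  finally show ?thesis
    by (simp add: card_cartesian_product power2_eq_square)
qed

text \<open>Either \<open>n\<close> is at most \<open>1 + t\<close>, or \<open>n - 1\<close> exceeds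
  \<open>t\<close> and the quotient alone is at least \<open>n\<close>. The case
  \<open>n = 0\<close> is set to cost nothing, so that summing over cells charges a line only for
  the cells it meets.\<close>

lemma nat_le_one_plus_pairs:
  fixes t :: real
  assumes "t > 0"
  shows "real n \<le> (if n = 0 then 0 else 1 + t) + real (n * (n - 1)) / t"
proof (cases "real n \<le> 1 + t")
  case True
  moreover have "0 \<le> real (n * (n - 1)) / t"
    using assms by simp
  ultimately show ?thesis
    by (split if_split, intro conjI impI) linarith+
next
  case False
  then have n: "n > 0" "real (n - 1) > t"
    using assms by (auto simp: of_nat_diff intro: gr0I)
  then have "real n * t \<le> real n * real (n - 1)"
    by (intro mult_left_mono) auto
  then have "real n \<le> real (n * (n - 1)) / t"
    using assms by (simp add: field_simps)
  then show ?thesis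
    using assms n by simp
qed

text \<open>The preceding bound is applied to \<open>n = card (l \<inter> X i)\<close> and summed
  over lines and cells. The first part is controlled line by line through \<open>s\<close>, the pair
  part cell by cell after exchanging the sums.\<close>

lemma incidences_few_cells_le:
  fixes s t M :: real
  assumes B: "finite B" "\<forall>l\<in>B. is_line l" "\<forall>l\<in>B. real (num_cells m X l) \<le> s"
    and P: "finite P" "disjoint_family_on X {1..m}" "(\<Union>i\<in>{1..m}. X i) = P"
    and M: "\<forall>i\<in>{1..m}. real (card (X i)) \<le> M"
    and t: "t > 0"
  shows "real (card (incidences B P)) \<le> (1 + t) * s * real (card B) + M * real (card P) / t"
proof -
  have finX: "finite (X i)" if "i \<in> {1..m}" for i
    using that P by (blast intro: finite_subset)
  have cardP: "card P = (\<Sum>i\<in>{1..m}. card (X i))"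
    unfolding P(3)[symmetric]
    by (rule card_UN_disjoint) (use finX P(2) in \<open>auto simp: disjoint_family_on_def\<close>)
  have line: "card (l \<inter> P) = (\<Sum>i\<in>{1..m}. card (l \<inter> X i))" for l
  proof -
    have "l \<inter> P = (\<Union>i\<in>{1..m}. l \<inter> X i)"
      using P(3) by auto
    also have "card \<dots> = (\<Sum>i\<in>{1..m}. card (l \<inter> X i))"
      by (rule card_UN_disjoint) (use finX P(2) in \<open>auto simp: disjoint_family_on_def\<close>)
    finally show ?thesis .
  qed
  have pairs: "(\<Sum>l\<in>B. real (card (l \<inter> X i) * (card (l \<inter> X i) - 1))) \<le> M * real (card (X i))"
    if i: "i \<in> {1..m}" for i
  proof -
    have "(\<Sum>l\<in>B. real (card (l \<inter> X i) * (card (l \<inter> X i) - 1))) \<le> real ((card (X i))\<^sup>2)"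
      using of_nat_mono[OF sum_collinear_pairs_le[OF B(1) finX[OF i] B(2)], where ?'a = real]
      by (simp only: of_nat_sum)
    \<comment> \<open>Only one factor of the square is replaced by \<open>M\<close>; the other sums
      over the cells to \<open>card P\<close>.\<close>
    also have "\<dots> \<le> M * real (card (X i))"
      using M i by (simp add: power2_eq_square mult_right_mono)
    finally show ?thesis .
  qed
  have cells: "(\<Sum>i\<in>{1..m}. if card (l \<inter> X i) = 0 then 0 else 1 + t) = (1 + t) * real (num_cells m X l)"
    for l
  proof -
    have "{i \<in> {1..m}. card (l \<inter> X i) \<noteq> 0} = {i \<in> {1..m}. \<exists>p\<in>X i. p \<in> l}"
      using finX by (auto simp: card_eq_0_iff)
    moreover have "(\<Sum>i\<in>{1..m}. if card (l \<inter> X i) = 0 then 0 else 1 + t) =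
        (\<Sum>i\<in>{i \<in> {1..m}. card (l \<inter> X i) \<noteq> 0}. 1 + t)"
      by (subst sum.inter_filter) (auto intro: sum.cong)
    ultimately show ?thesis
      by (simp add: num_cells_def)
  qed
  have "real (card (incidences B P)) = (\<Sum>l\<in>B. \<Sum>i\<in>{1..m}. real (card (l \<inter> X i)))"
    using card_incidences[OF B(1) P(1)] line by simp
  also have "\<dots> \<le> (\<Sum>l\<in>B. \<Sum>i\<in>{1..m}. (if card (l \<inter> X i) = 0 then 0 else 1 + t) +
      real (card (l \<inter> X i) * (card (l \<inter> X i) - 1)) / t)"
    by (intro sum_mono nat_le_one_plus_pairs[OF t])
  also have "\<dots> = (\<Sum>l\<in>B. (1 + t) * real (num_cells m X l)) +
      (\<Sum>l\<in>B. \<Sum>i\<in>{1..m}. real (card (l \<inter> X i) * (card (l \<inter> X i) - 1))) / t"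
    by (simp only: sum.distrib cells sum_divide_distrib)
  also have "(\<Sum>l\<in>B. \<Sum>i\<in>{1..m}. real (card (l \<inter> X i) * (card (l \<inter> X i) - 1))) =
      (\<Sum>i\<in>{1..m}. \<Sum>l\<in>B. real (card (l \<inter> X i) * (card (l \<inter> X i) - 1)))"
    by (rule sum.swap)
  also have "(\<Sum>l\<in>B. (1 + t) * real (num_cells m X l)) \<le> (\<Sum>l\<in>B. (1 + t) * s)"
    using B(3) t by (intro sum_mono mult_left_mono) auto
  also have "(\<Sum>i\<in>{1..m}. \<Sum>l\<in>B. real (card (l \<inter> X i) * (card (l \<inter> X i) - 1))) \<le>
      (\<Sum>i\<in>{1..m}. M * real (card (X i)))"
    by (intro sum_mono pairs)
  finally show ?thesis
    using t by (simp add: cardP sum_distrib_left divide_right_mono mult_ac)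
qed

text \<open>As \<open>N \<ge> 1\<close>, the unspecified loss may be enlarged to the maximal one,
  which gives all hypotheses a common explicit exponent.\<close>

lemma gtrsim_minusD:
  assumes "gtrsim_minus K C \<epsilon>0 N a A" "N \<ge> 1"
  shows "N powr (a - K * \<epsilon>0) \<le> C * A"
proof -
  from assms(1) obtain \<epsilon> where "\<epsilon> \<le> K * \<epsilon>0" "N powr (a - \<epsilon>) \<le> C * A"
    unfolding gtrsim_minus_def by auto
  moreover from this have "N powr (a - K * \<epsilon>0) \<le> N powr (a - \<epsilon>)"
    using assms(2) by (intro powr_mono) auto
  ultimately show ?thesis
    by linarith
qed

theorem theorem2p6:
  fixes K C :: real
  assumes "K > 0" and "C > 0"
  shows "\<exists>K' C'. K' > 0 \<and> C' > 0 \<and>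
    (\<forall>(\<epsilon>0::real) (N::real) (L :: (real ^ 2) set set) (P :: (real ^ 2) set)
       (r::real) (m::nat) (X :: nat \<Rightarrow> (real ^ 2) set).
      \<epsilon>0 > 0 \<longrightarrow> N \<ge> 1 \<longrightarrow>
      extremal_configuration K C \<epsilon>0 N L P \<longrightarrow>
      point_weighted_cell_decomposition K C \<epsilon>0 N L P r m X \<longrightarrow>
      sim_plusminus K C \<epsilon>0 N (1/3) r \<longrightarrow>
      (\<exists>L'. L' \<subseteq> L \<and>
         gtrsim_minus K' C' \<epsilon>0 N (4/3) (real (card (incidences L' P))) \<and>
         (\<forall>l\<in>L'. gtrsim_minus K' C' \<epsilon>0 N (1/3) (real (num_cells m X l)))))"
proof -
  \<comment> \<open>Chosen so that \<open>C ^ 3 / A = 1 / (4 * C)\<close>, which makes the pair term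
    a quarter of the guaranteed incidences.\<close>
  define A where "A = 4 * C ^ 4"
  \<comment> \<open>The first entry pays for keeping half of the incidences, the second for the
    denominator of the threshold \<open>s\<close>.\<close>
  define C' where "C' = max (2 * C) (4 * C * (1 + A))"
  have A: "A > 0"
    using \<open>C > 0\<close> by (simp add: A_def)
  have C': "C' > 0" "2 * C \<le> C'" "4 * C * (1 + A) \<le> C'"
    using \<open>C > 0\<close> by (auto simp: C'_def)
  have main: "\<exists>L'. L' \<subseteq> L \<and>
      gtrsim_minus (5 * K) C' \<epsilon>0 N (4/3) (real (card (incidences L' P))) \<and>
      (\<forall>l\<in>L'. gtrsim_minus (5 * K) C' \<epsilon>0 N (1/3) (real (num_cells m X l)))"
    if \<epsilon>0: "\<epsilon>0 > 0" and N: "N \<ge> 1" and ext: "extremal_configuration K C \<epsilon>0 N L P"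
      and dec: "point_weighted_cell_decomposition K C \<epsilon>0 N L P r m X"
      and sim: "sim_plusminus K C \<epsilon>0 N (1/3) r"
    for \<epsilon>0 N r :: real and L :: "(real ^ 2) set set" and P m X
  proof -
    define \<delta> where "\<delta> = K * \<epsilon>0"
    \<comment> \<open>The exponents balance in both error terms:
      \<open>4 * \<delta> + (1/3 - 5 * \<delta>) + 1\<close> and
      \<open>(1/3 + 3 * \<delta>) + 1 - 4 * \<delta>\<close> are both \<open>4/3 - \<delta>\<close>.
      The loss \<open>5 * \<delta>\<close> is the largest one and dictates
      \<open>5 * K\<close>.\<close>
    define s where "s = N powr (1/3 - 5 * \<delta>) / (4 * C * (1 + A))"
    define t where "t = A * N powr (4 * \<delta>)"
    define L' where "L' = {l \<in> L. s < real (num_cells m X l)}"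
    have \<delta>: "\<delta> \<ge> 0"
      using \<open>K > 0\<close> \<epsilon>0 by (simp add: \<delta>_def)
    have L: "finite L" "\<forall>l\<in>L. is_line l" "real (card L) \<le> N"
      and P: "finite P" "real (card P) \<le> N"
      and inc: "N powr (4/3 - \<delta>) \<le> C * real (card (incidences L P))"
      using ext gtrsim_minusD[OF _ N, of K C \<epsilon>0 "4/3"]
      by (auto simp: extremal_configuration_def configuration_def \<delta>_def)
    have r: "r > 0" "N powr (1/3 - \<delta>) \<le> C * r"
      and X: "disjoint_family_on X {1..m}" "(\<Union>i\<in>{1..m}. X i) = P"
      using dec sim gtrsim_minusD[OF _ N, of K C \<epsilon>0 "1/3"]
      by (auto simp: point_weighted_cell_decomposition_def sim_plusminus_def \<delta>_def)
    \<comment> \<open>The lower bound on \<open>r\<close> enters squared: it contributes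
      \<open>C\<^sup>2\<close> and turns the exponent \<open>1 + \<delta>\<close> into
      \<open>1 + \<delta> - 2 * (1/3 - \<delta>)\<close>.\<close>
    have cell: "real (card (X i)) \<le> C ^ 3 * N powr (1/3 + 3 * \<delta>)" if i: "i \<in> {1..m}" for i
    proof -
      obtain \<epsilon> where \<epsilon>: "\<epsilon> \<le> \<delta>" "real (card (X i)) \<le> C * (N powr (1 + \<epsilon>) / r\<^sup>2)"
        using dec i by (auto simp: point_weighted_cell_decomposition_def \<delta>_def)
      have "(N powr (1/3 - \<delta>))\<^sup>2 \<le> (C * r)\<^sup>2"
        using r by (intro power_mono) auto
      then have "N powr (2/3 - 2 * \<delta>) \<le> C\<^sup>2 * r\<^sup>2"
        using N by (simp add: power2_eq_square powr_add[symmetric] mult_ac)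
      then have "N powr (1/3 + 3 * \<delta>) * N powr (2/3 - 2 * \<delta>) \<le> N powr (1/3 + 3 * \<delta>) * (C\<^sup>2 * r\<^sup>2)"
        by (intro mult_left_mono) auto
      then have "N powr (1 + \<delta>) \<le> N powr (1/3 + 3 * \<delta>) * (C\<^sup>2 * r\<^sup>2)"
        by (simp add: powr_add[symmetric])
      moreover have "N powr (1 + \<epsilon>) \<le> N powr (1 + \<delta>)"
        using N \<epsilon> by (intro powr_mono) auto
      ultimately have "N powr (1 + \<epsilon>) / r\<^sup>2 \<le> N powr (1/3 + 3 * \<delta>) * C\<^sup>2"
        using r by (simp add: divide_simps mult_ac)
      then have "C * (N powr (1 + \<epsilon>) / r\<^sup>2) \<le> C * (N powr (1/3 + 3 * \<delta>) * C\<^sup>2)"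
        using \<open>C > 0\<close> by (intro mult_left_mono) auto
      with \<epsilon> show ?thesis
        by (simp add: power2_eq_square power3_eq_cube mult_ac)
    qed
    have s: "s \<ge> 0"
      using \<open>C > 0\<close> A by (simp add: s_def)
    have t: "t > 0"
      using A N by (simp add: t_def)
    have "real (card (incidences (L - L') P)) \<le>
        (1 + t) * s * real (card (L - L')) + C ^ 3 * N powr (1/3 + 3 * \<delta>) * real (card P) / t"
      by (rule incidences_few_cells_le[where m = m and X = X]) (use L P X cell t in \<open>auto simp: L'_def\<close>)
    also have "(1 + t) * s * real (card (L - L')) \<le> (1 + A) * N powr (4 * \<delta>) * s * N"
    proof (intro mult_mono)
      \<comment> \<open>This absorbs the summand 1 of \<open>1 + t\<close> into the power of
        \<open>N\<close>.\<close>
      have "1 \<le> N powr (4 * \<delta>)"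
        using N \<delta> by (simp add: ge_one_powr_ge_zero)
      then show "1 + t \<le> (1 + A) * N powr (4 * \<delta>)"
        by (simp add: t_def algebra_simps)
      have "card (L - L') \<le> card L"
        using L by (intro card_mono) auto
      then show "real (card (L - L')) \<le> N"
        using L by simp
    qed (use s t A in auto)
    also have "\<dots> = N powr (4/3 - \<delta>) / (4 * C)"
    proof -
      have "(1 + A) * u * (v / (4 * C * (1 + A))) * N = u * v * N / (4 * C)" for u v
        using A \<open>C > 0\<close> by (simp add: divide_simps)
      moreover have "N powr (4 * \<delta>) * N powr (1/3 - 5 * \<delta>) * N powr 1 = N powr (4/3 - \<delta>)"
        by (simp only: powr_add[symmetric]) simp
      ultimately show ?thesis
        using N unfolding s_def by (metis powr_one zero_le_one order_trans)
    qed
    also have "C ^ 3 * N powr (1/3 + 3 * \<delta>) * real (card P) / t \<le> C ^ 3 * N powr (1/3 + 3 * \<delta>) * N / t"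
      using P t \<open>C > 0\<close> by (intro divide_right_mono mult_left_mono) auto
    also have "\<dots> = N powr (4/3 - \<delta>) / (4 * C)"
    proof -
      have "C ^ 3 * (u * v) / (A * v) = u / (4 * C)" if "v > 0" for u v
        using that \<open>C > 0\<close> by (simp add: A_def divide_simps power_numeral_reduce)
      moreover have "N powr (4/3 - \<delta>) * N powr (4 * \<delta>) = N powr (1/3 + 3 * \<delta>) * N powr 1"
        by (simp only: powr_add[symmetric]) (simp add: add.commute)
      moreover have "N powr (4 * \<delta>) > 0" "N powr 1 = N"
        using N by auto
      ultimately show ?thesis
        unfolding t_def by (metis mult.assoc)
    qed
    \<comment> \<open>Two quarters add up to half of the lower bound
      \<open>N powr (4/3 - \<delta>) / C\<close> for all incidences, so the other half remains on
      \<open>L'\<close>.\<close>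
    finally have bad: "real (card (incidences (L - L') P)) \<le> N powr (4/3 - \<delta>) / (2 * C)"
      by simp
    \<comment> \<open>Incidences are a sum over lines, hence additive over the splitting of
      \<open>L\<close>.\<close>
    have "card (incidences L P) = card (incidences L' P) + card (incidences (L - L') P)"
      using L P sum.subset_diff[of L' L "\<lambda>l. card (l \<inter> P)"]
      by (simp add: card_incidences finite_subset[of L' L] L'_def)
    then have "real (card (incidences L P)) \<le> real (card (incidences L' P)) + N powr (4/3 - \<delta>) / (2 * C)"
      using bad by simp
    then have "C * real (card (incidences L P)) \<le>
        C * (real (card (incidences L' P)) + N powr (4/3 - \<delta>) / (2 * C))"
      using \<open>C > 0\<close> by (intro mult_left_mono) auto
    with inc have "N powr (4/3 - \<delta>) \<le> C * (real (card (incidences L' P)) + N powr (4/3 - \<delta>) / (2 * C))"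
      by linarith
    then have "N powr (4/3 - \<delta>) \<le> 2 * C * real (card (incidences L' P))"
      using \<open>C > 0\<close> by (simp add: field_simps)
    also have "\<dots> \<le> C' * real (card (incidences L' P))"
      using C' by (intro mult_right_mono) auto
    finally have "gtrsim_minus (5 * K) C' \<epsilon>0 N (4/3) (real (card (incidences L' P)))"
      using \<delta> unfolding gtrsim_minus_def by (intro exI[of _ \<delta>]) (auto simp: \<delta>_def)
    moreover have "gtrsim_minus (5 * K) C' \<epsilon>0 N (1/3) (real (num_cells m X l))" if l: "l \<in> L'" for l
    proof -
      have "N powr (1/3 - 5 * \<delta>) \<le> 4 * C * (1 + A) * real (num_cells m X l)"
        using l A \<open>C > 0\<close> by (simp add: L'_def s_def divide_simps mult_ac)
      also have "\<dots> \<le> C' * real (num_cells m X l)"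
        using C' by (intro mult_right_mono) auto
      finally show ?thesis
        using \<delta> unfolding gtrsim_minus_def by (intro exI[of _ "5 * \<delta>"]) (auto simp: \<delta>_def)
    qed
    ultimately show ?thesis
      by (intro exI[of _ L']) (auto simp: L'_def)
  qed
  show ?thesis
    by (rule exI[of _ "5 * K"], rule exI[of _ C']) (use main \<open>K > 0\<close> C' in auto)
qed

end
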